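(* There exists a monotonically growing temporal clique $\mathcal{Q}$ (that is, a monotonically growing temporal graph whose underlying static graph is a complete graph) such that there is no Nash equilibrium in the two-player reverse temporal Voronoi game $\mathrm{rVor}(\mathcal{Q},2)$.
   Context: A temporal graph $\mathcal{G}=(V,(E_t)_{t=1}^\infty)$ consists of a finite nonempty vertex set $V$ and an infinite sequence of edge sets $E_t\subseteq\binom{V}{2}$; it is assumed that the sequence is eventually constant (finite lifetime), i.e. there is $\tau$ with $E_t=E_\tau$ for all $t\ge\tau$. The underlying static graph is $(V,\bigcup_{t\ge1}E_t)$. A temporal clique is a temporal graph whose underlying graph is complete. $\mathcal{G}$ is monotonically growing if $E_t\subseteq E_{t+1}$ for all $t\ge 1$. A temporal walk from $u$ to $v$ is a sequence $(\{v_0=u,v_1\},t_1),(\{v_1,v_2\},t_2),\dots,(\{v_{d-1},v_d=v\},t_d)$ with $t_i<t_{i+1}$ for all $i\in\{1,\dots,d-1\}$ (strictly increasing times) and $\{v_{i-1},v_i\}\in E_{t_i}$ for all $i\in\{1,\dots,d\}$; its arrival time is $t_d$. The temporal distance $\mathrm{td}(u,v)$ is the minimum arrival time of a temporal walk from $u$ to $v$, with $\mathrm{td}(u,u)=0$ and $\mathrm{td}(u,v)=\infty$ if there is no such walk. In the two-player reverse temporal Voronoi game $\mathrm{rVor}(\mathcal{G},2)$, each player $i\in\{1,2\}$ selects one vertex $p_i\in V$ (equal choices are allowed). Player $i$ wins the set $U_i(p_1,p_2)=\{v\in V\mid \mathrm{td}(v,p_i)<\mathrm{td}(v,p_j)\}$,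 where $j\ne i$ is the other player, and her payoff is $u_i(p_1,p_2)=|U_i(p_1,p_2)|$. A profile $(p_1,p_2)\in V^2$ is a Nash equilibrium if $u_1(p',p_2)\le u_1(p_1,p_2)$ and $u_2(p_1,p')\le u_2(p_1,p_2)$ for all $p'\in V$. *)

theory Defs
  imports "HOL-Library.Extended_Nat"
begin

text \<open>
  Time steps are the positive natural numbers. The value of the field \<open>edges\<close> at 0 is junk:
  every definition below ignores it.
\<close>

record 'a tgraph =
  verts :: "'a set"
  edges :: "nat \<Rightarrow> 'a set set"

definition vertex_pairs :: "'a set \<Rightarrow> 'a set set" where
  "vertex_pairs V = {e. e \<subseteq> V \<and> card e = 2}"

definition temporal_graph :: "'a tgraph \<Rightarrow> bool" where
  "temporal_graph G \<longleftrightarrow>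
     finite (verts G) \<and> verts G \<noteq> {} \<and>
     (\<forall>t\<ge>1. edges G t \<subseteq> vertex_pairs (verts G)) \<and>
     (\<exists>\<tau>\<ge>1. \<forall>t\<ge>\<tau>. edges G t = edges G \<tau>)"

definition underlying_edges :: "'a tgraph \<Rightarrow> 'a set set" where
  "underlying_edges G = (\<Union>t\<in>{1..}. edges G t)"

definition temporal_clique :: "'a tgraph \<Rightarrow> bool" where
  "temporal_clique G \<longleftrightarrow>
     temporal_graph G \<and> underlying_edges G = vertex_pairs (verts G)"

definition monotonically_growing :: "'a tgraph \<Rightarrow> bool" where
  "monotonically_growing G \<longleftrightarrow> (\<forall>t\<ge>1. edges G t \<subseteq> edges G (t + 1))"

text \<open>
  A walk is the list of its (edge, time) pairs; \<open>vs\<close> lists the visited vertices. Walks have at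
  least one edge, the trivial case being covered by the convention in \<open>temporal_dist\<close>.
\<close>

definition temporal_walk :: "'a tgraph \<Rightarrow> 'a \<Rightarrow> 'a \<Rightarrow> ('a set \<times> nat) list \<Rightarrow> bool" where
  "temporal_walk G u v w \<longleftrightarrow>
     w \<noteq> [] \<and>
     (\<exists>vs. length vs = length w + 1 \<and> vs ! 0 = u \<and> vs ! length w = v \<and>
        (\<forall>i<length w. fst (w ! i) = {vs ! i, vs ! (i + 1)} \<and>
                      snd (w ! i) \<ge> 1 \<and> fst (w ! i) \<in> edges G (snd (w ! i)))) \<and>
     (\<forall>i. i + 1 < length w \<longrightarrow> snd (w ! i) < snd (w ! (i + 1)))"

definition arrival_time :: "('a set \<times> nat) list \<Rightarrow> nat" where
  "arrival_time w = snd (last w)"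

text \<open>
  On \<^typ>\<open>enat\<close> the infimum of a nonempty set is its minimum and the infimum of the empty set
  is \<open>\<infinity>\<close>.
\<close>

definition temporal_dist :: "'a tgraph \<Rightarrow> 'a \<Rightarrow> 'a \<Rightarrow> enat" where
  "temporal_dist G u v =
     (if u = v then 0 else Inf {enat (arrival_time w) | w. temporal_walk G u v w})"

text \<open>
  \<open>rvor_set G p q\<close> is the set won by a player on \<open>p\<close> against an opponent on \<open>q\<close>; distances are
  taken from the vertices to the players.
\<close>

definition rvor_set :: "'a tgraph \<Rightarrow> 'a \<Rightarrow> 'a \<Rightarrow> 'a set" where
  "rvor_set G p q = {v \<in> verts G. temporal_dist G v p < temporal_dist G v q}"

definition rvor_payoff1 :: "'a tgraph \<Rightarrow> 'a \<Rightarrow> 'a \<Rightarrow> nat" where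
  "rvor_payoff1 G p1 p2 = card (rvor_set G p1 p2)"

definition rvor_payoff2 :: "'a tgraph \<Rightarrow> 'a \<Rightarrow> 'a \<Rightarrow> nat" where
  "rvor_payoff2 G p1 p2 = card (rvor_set G p2 p1)"

definition rvor_nash :: "'a tgraph \<Rightarrow> 'a \<Rightarrow> 'a \<Rightarrow> bool" where
  "rvor_nash G p1 p2 \<longleftrightarrow>
     p1 \<in> verts G \<and> p2 \<in> verts G \<and>
     (\<forall>p'\<in>verts G. rvor_payoff1 G p' p2 \<le> rvor_payoff1 G p1 p2) \<and>
     (\<forall>p'\<in>verts G. rvor_payoff2 G p1 p' \<le> rvor_payoff2 G p1 p2)"

end

theory Submission
  imports Defs
begin

text \<open>
  The witness has vertices \<open>0, \<dots>, 4\<close>. The edges \<open>12\<close> and \<open>34\<close> appear at time 1, \<open>23\<close> at time 2,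
  \<open>01\<close> and \<open>04\<close> at time 3 (which completes a 5-cycle), and the five chords at time 4.
  Temporal distances from a fixed vertex are determined by a Bellman equation, so the claimed
  distance matrix can be checked entrywise. The best responses to 1, 2, 4, 3 are 2, 4, 3, 1,
  respectively, and those to 0 are 2 and 3, so no two vertices are best responses to each other.
\<close>

section \<open>Temporal walks and their arrival times\<close>

lemma temporal_walk_single:
  assumes "{u, v} \<in> edges G t" and "t \<ge> 1"
  shows "temporal_walk G u v [({u, v}, t)]"
  unfolding temporal_walk_def using assms
  by (auto intro!: exI[of _ "[u, v]"])

lemma temporal_walk_snoc:
  assumes "temporal_walk G u x w" and "arrival_time w < t" and "{x, y} \<in> edges G t"
  shows "temporal_walk G u y (w @ [({x, y}, t)])"
proof -
  obtain vs where vs: "length vs = length w + 1" "vs ! 0 = u" "vs ! length w = x"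
      "\<And>i. i < length w \<Longrightarrow> fst (w ! i) = {vs ! i, vs ! (i + 1)} \<and>
         snd (w ! i) \<ge> 1 \<and> fst (w ! i) \<in> edges G (snd (w ! i))"
    and ne: "w \<noteq> []"
    and inc: "\<And>i. i + 1 < length w \<Longrightarrow> snd (w ! i) < snd (w ! (i + 1))"
    using assms(1) unfolding temporal_walk_def by blast
  have last: "arrival_time w = snd (w ! (length w - 1))"
    using ne by (simp add: arrival_time_def last_conv_nth)
  let ?w = "w @ [({x, y}, t)]" and ?vs = "vs @ [y]"
  have "fst (?w ! i) = {?vs ! i, ?vs ! (i + 1)} \<and>
      snd (?w ! i) \<ge> 1 \<and> fst (?w ! i) \<in> edges G (snd (?w ! i))" if "i < length ?w" for i
  proof (cases "i < length w")
    case True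
    then have "?w ! i = w ! i" "?vs ! i = vs ! i" "?vs ! (i + 1) = vs ! (i + 1)"
      using vs(1) by (simp_all add: nth_append)
    then show ?thesis using vs(4)[OF True] by metis
  next
    case False
    then have "i = length w" using that by simp
    \<comment> \<open>The new time is positive because it exceeds
      \<open>arrival_time w\<close>.\<close>
    then show ?thesis using vs(1,3) assms(2,3) by (simp add: nth_append)
  qed
  moreover have "snd (?w ! i) < snd (?w ! (i + 1))" if "i + 1 < length ?w" for i
  proof (cases "i + 1 < length w")
    case True
    then show ?thesis using inc[of i] by (simp add: nth_append)
  next
    case False
    then have "i = length w - 1" "i < length w" "i + 1 = length w" using that ne by auto
    then show ?thesis using last assms(2) by (simp add: nth_append)
  qed
  moreover have "length ?vs = length ?w + 1" "?vs ! 0 = u" "?vs ! length ?w = y" "?w \<noteq> []"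
    using vs(1,2) by (simp_all add: nth_append)
  ultimately show ?thesis
    unfolding temporal_walk_def by blast
qed

text \<open>
  The first assumption on edges makes \<open>d\<close> a lower bound along every walk; the second one lets a
  walk arriving at time \<open>d v\<close> be traced back from \<open>v\<close>.
\<close>

lemma temporal_dist_eqI:
  fixes d :: "'a \<Rightarrow> nat"
  assumes source: "d u = 0"
    and lower: "\<And>x y t. {x, y} \<in> edges G t \<Longrightarrow> d x < t \<Longrightarrow> d y \<le> t"
    and attained: "\<And>y. y \<in> V \<Longrightarrow> y \<noteq> u \<Longrightarrow> \<exists>x\<in>V. d x < d y \<and> {x, y} \<in> edges G (d y)"
    and v: "v \<in> V"
  shows "temporal_dist G u v = enat (d v)"
proof (cases "v = u")
  case True
  then show ?thesis by (simp add: temporal_dist_def source zero_enat_def)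
next
  case False
  \<comment> \<open>A walk to the predecessor arrives before time \<open>d y\<close>, so it can be
    extended by an edge taken at exactly that time. The case \<open>x = u\<close> is separate
    because walks are nonempty.\<close>
  have walk: "\<exists>w. temporal_walk G u y w \<and> arrival_time w = d y" if "y \<in> V" "y \<noteq> u" for y
    using that
  proof (induction "d y" arbitrary: y rule: less_induct)
    case less
    then obtain x where x: "x \<in> V" "d x < d y" "{x, y} \<in> edges G (d y)"
      using attained by blast
    show ?case
    proof (cases "x = u")
      case True
      with x show ?thesis
        using temporal_walk_single[of u y G "d y"] by (auto simp: arrival_time_def)
    next
      case False
      with less.hyps x obtain w where "temporal_walk G u x w" "arrival_time w = d x" by blast
      with x show ?thesis
        using temporal_walk_snoc[of G u x w "d y" y] by (auto simp: arrival_time_def)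
    qed
  qed
  have bound: "d v \<le> arrival_time w" if w: "temporal_walk G u v w" for w
  proof -
    obtain vs where vs: "length vs = length w + 1" "vs ! 0 = u" "vs ! length w = v"
        "\<And>i. i < length w \<Longrightarrow> fst (w ! i) = {vs ! i, vs ! (i + 1)} \<and>
           snd (w ! i) \<ge> 1 \<and> fst (w ! i) \<in> edges G (snd (w ! i))"
      and ne: "w \<noteq> []"
      and inc: "\<And>i. i + 1 < length w \<Longrightarrow> snd (w ! i) < snd (w ! (i + 1))"
      using w unfolding temporal_walk_def by blast
    have edge: "{vs ! i, vs ! Suc i} \<in> edges G (snd (w ! i))" "0 < snd (w ! i)"
      if "i < length w" for i
      using vs(4)[OF that] by (metis Suc_eq_plus1, linarith)
    \<comment> \<open>Times are positive, so \<open>d u = 0\<close> lies below the first one.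
      Afterwards the strict increase of times turns the bound at one edge into the strict inequality
      that \<open>lower\<close> requires at the next.\<close>
    have "d (vs ! (i + 1)) \<le> snd (w ! i)" if "i < length w" for i
      using that
    proof (induction i)
      case 0
      then show ?case using vs(2) source edge[of 0] lower[of "vs ! 0" "vs ! 1"] by simp
    next
      case (Suc i)
      then have "d (vs ! Suc i) < snd (w ! Suc i)" using inc[of i] by simp
      then show ?case
        using edge(1)[OF Suc.prems] lower[of "vs ! Suc i" "vs ! Suc (Suc i)"] by simp
    qed
    from this[of "length w - 1"] show ?thesis
      using ne vs(3) by (simp add: arrival_time_def last_conv_nth)
  qed
  let ?A = "{enat (arrival_time w) | w. temporal_walk G u v w}"
  obtain w where "temporal_walk G u v w" "arrival_time w = d v"
    using walk[OF v False] by blast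
  then have "Inf ?A \<le> enat (d v)" by (force intro: Inf_lower)
  moreover have "enat (d v) \<le> Inf ?A" by (rule Inf_greatest) (auto dest: bound)
  ultimately show ?thesis using False by (simp add: temporal_dist_def)
qed

section \<open>Growing graphs given by edge appearance times\<close>

text \<open>A growing graph is determined by the times at which its edges first appear. If
  \<open>l x y\<close> and \<open>l y x\<close> differ, the smaller one counts.\<close>

definition appearance_graph :: "'a set \<Rightarrow> ('a \<Rightarrow> 'a \<Rightarrow> nat) \<Rightarrow> 'a tgraph" where
  "appearance_graph V l =
     \<lparr>verts = V, edges = \<lambda>t. {{x, y} | x y. x \<in> V \<and> y \<in> V \<and> x \<noteq> y \<and> l x y \<le> t}\<rparr>"

lemma verts_appearance_graph [simp]: "verts (appearance_graph V l) = V"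
  by (simp add: appearance_graph_def)

lemma edge_appearance_graph_iff:
  assumes "\<And>x y. x \<in> V \<Longrightarrow> y \<in> V \<Longrightarrow> l x y = l y x"
  shows "{x, y} \<in> edges (appearance_graph V l) t \<longleftrightarrow>
           x \<in> V \<and> y \<in> V \<and> x \<noteq> y \<and> l x y \<le> t"
  using assms by (auto simp: appearance_graph_def doubleton_eq_iff)

lemma monotonically_growing_appearance_graph:
  "monotonically_growing (appearance_graph V l)"
  by (fastforce simp: monotonically_growing_def appearance_graph_def)

text \<open>From time \<open>T\<close> on every pair is present, which gives both the finite
  lifetime and completeness.\<close>

lemma temporal_clique_appearance_graph:
  assumes "finite V" and "V \<noteq> {}" and bound: "\<And>x y. x \<in> V \<Longrightarrow> y \<in> V \<Longrightarrow> l x y \<le> T"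
  shows "temporal_clique (appearance_graph V l)"
proof -
  let ?G = "appearance_graph V l"
  have sub: "edges ?G t \<subseteq> vertex_pairs V" for t
    by (auto simp: appearance_graph_def vertex_pairs_def)
  have full: "edges ?G t = vertex_pairs V" if "T \<le> t" for t
  proof
    show "vertex_pairs V \<subseteq> edges ?G t"
    proof
      fix e assume "e \<in> vertex_pairs V"
      then obtain x y where "e = {x, y}" "x \<noteq> y" "x \<in> V" "y \<in> V"
        by (auto simp: vertex_pairs_def card_2_iff)
      then show "e \<in> edges ?G t"
        using bound[of x y] that by (auto simp: appearance_graph_def intro: order_trans)
    qed
  qed (rule sub)
  \<comment> \<open>The witness is \<open>Suc T\<close> because \<open>T\<close> may be 0, which is
    not a time step.\<close>
  have "\<exists>\<tau>\<ge>1. \<forall>t\<ge>\<tau>. edges ?G t = edges ?G \<tau>"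
    by (rule exI[of _ "Suc T"]) (simp add: full)
  moreover have "underlying_edges ?G = vertex_pairs V"
  proof
    show "vertex_pairs V \<subseteq> underlying_edges ?G"
      using full[of "Suc T"] by (force simp: underlying_edges_def)
  qed (use sub in \<open>auto simp: underlying_edges_def\<close>)
  ultimately show ?thesis
    using assms(1,2) sub by (simp add: temporal_clique_def temporal_graph_def)
qed

section \<open>The five-vertex clique: tables and finite checks\<close>

definition cycle_label :: "nat \<Rightarrow> nat \<Rightarrow> nat" where
  "cycle_label x y =
     [[0, 3, 4, 4, 3],
      [3, 0, 1, 4, 4],
      [4, 1, 0, 2, 4],
      [4, 4, 2, 0, 1],
      [3, 4, 4, 1, 0]] ! x ! y"

text \<open>Rows are sources, and the table is not symmetric: 2 reaches 0 at time 3 via 1, whereas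
  no edge leaves 0 before time 3, so 0 reaches 2 only at time 4.\<close>

definition cycle_dist :: "nat \<Rightarrow> nat \<Rightarrow> nat" where
  "cycle_dist u v =
     [[0, 3, 4, 4, 3],
      [3, 0, 1, 2, 3],
      [3, 1, 0, 2, 3],
      [3, 3, 2, 0, 1],
      [3, 3, 2, 1, 0]] ! u ! v"

definition cycle_payoff :: "nat \<Rightarrow> nat \<Rightarrow> nat" where
  "cycle_payoff p q = length (filter (\<lambda>v. cycle_dist v p < cycle_dist v q) [0..<5])"

lemma five_interval: "{0..<5} = {0, 1, 2, 3, 4 :: nat}"
  by auto

lemma cycle_label_bound: "\<forall>x\<in>{0..<5}. \<forall>y\<in>{0..<5}. cycle_label x y \<le> 4"
  by (simp add: five_interval cycle_label_def cycle_dist_def)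

lemma cycle_label_sym: "\<forall>x\<in>{0..<5}. \<forall>y\<in>{0..<5}. cycle_label x y = cycle_label y x"
  by (simp add: five_interval cycle_label_def cycle_dist_def)

lemma cycle_dist_self: "\<forall>u\<in>{0..<5}. cycle_dist u u = 0"
  by (simp add: five_interval cycle_label_def cycle_dist_def)

text \<open>Since edges persist, a walk at \<open>x\<close> can use the edge to \<open>y\<close> at
  the first time that is strictly later than its arrival and not before the appearance of the
  edge.\<close>

lemma cycle_dist_step:
  "\<forall>u\<in>{0..<5}. \<forall>x\<in>{0..<5}. \<forall>y\<in>{0..<5}.
     x \<noteq> y \<longrightarrow> cycle_dist u y \<le> max (cycle_dist u x + 1) (cycle_label x y)"
  by (simp add: five_interval cycle_label_def cycle_dist_def)

text \<open>The other half of the Bellman equation: \<open>x\<close> is the penultimate vertex of a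
  fastest walk to \<open>y\<close>.\<close>

lemma cycle_dist_attained:
  "\<forall>u\<in>{0..<5}. \<forall>y\<in>{0..<5}. y \<noteq> u \<longrightarrow>
     (\<exists>x\<in>{0..<5}. x \<noteq> y \<and> cycle_dist u x < cycle_dist u y \<and> cycle_label x y \<le> cycle_dist u y)"
  by (simp add: five_interval cycle_label_def cycle_dist_def)

text \<open>By the symmetry of the game one function gives both payoffs; the disjuncts are a
  profitable move to \<open>r\<close> by the first and by the second player.\<close>

lemma cycle_payoff_deviation:
  "\<forall>p\<in>{0..<5}. \<forall>q\<in>{0..<5}. \<exists>r\<in>{0..<5}.
     cycle_payoff p q < cycle_payoff r q \<or> cycle_payoff q p < cycle_payoff r p"
  by (simp add: five_interval cycle_payoff_def cycle_dist_def upt_rec)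

section \<open>Transfer from the tables to the game\<close>

definition cycle_clique :: "nat tgraph" where
  "cycle_clique = appearance_graph {0..<5} cycle_label"

lemma verts_cycle_clique [simp]: "verts cycle_clique = {0..<5}"
  by (simp add: cycle_clique_def)

lemma edge_cycle_clique_iff:
  "{x, y} \<in> edges cycle_clique t \<longleftrightarrow>
     x \<in> {0..<5} \<and> y \<in> {0..<5} \<and> x \<noteq> y \<and> cycle_label x y \<le> t"
  unfolding cycle_clique_def using cycle_label_sym by (intro edge_appearance_graph_iff) blast

lemma temporal_dist_cycle_clique:
  assumes u: "u \<in> {0..<5}" and v: "v \<in> {0..<5}"
  shows "temporal_dist cycle_clique u v = enat (cycle_dist u v)"
proof (rule temporal_dist_eqI[where V = "{0..<5}"])
  show "cycle_dist u u = 0" using cycle_dist_self u by blast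
next
  fix x y t
  assume "{x, y} \<in> edges cycle_clique t" and "cycle_dist u x < t"
  moreover from this have "cycle_dist u y \<le> max (cycle_dist u x + 1) (cycle_label x y)"
    using cycle_dist_step u unfolding edge_cycle_clique_iff by blast
  \<comment> \<open>Both terms of the maximum are at most \<open>t\<close>: the first by
    integrality, the second because the edge is present at time \<open>t\<close>.\<close>
  ultimately show "cycle_dist u y \<le> t"
    by (simp add: edge_cycle_clique_iff max_def split: if_splits)
next
  fix y :: nat
  assume "y \<in> {0..<5}" "y \<noteq> u"
  then show "\<exists>x\<in>{0..<5}. cycle_dist u x < cycle_dist u y \<and>
      {x, y} \<in> edges cycle_clique (cycle_dist u y)"
    using cycle_dist_attained u unfolding edge_cycle_clique_iff by blast
qed (rule v)

lemma card_rvor_set_cycle_clique: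
  assumes "p \<in> {0..<5}" and "q \<in> {0..<5}"
  shows "card (rvor_set cycle_clique p q) = cycle_payoff p q"
proof -
  have "rvor_set cycle_clique p q =
      set (filter (\<lambda>v. cycle_dist v p < cycle_dist v q) [0..<5])"
    using assms by (auto simp: rvor_set_def temporal_dist_cycle_clique)
  then show ?thesis
    by (simp only: cycle_payoff_def distinct_card distinct_filter distinct_upt)
qed

lemma not_rvor_nash_cycle_clique: "\<not> rvor_nash cycle_clique p q"
proof
  assume nash: "rvor_nash cycle_clique p q"
  then have pq: "p \<in> {0..<5}" "q \<in> {0..<5}" by (simp_all add: rvor_nash_def)
  then obtain r where r: "r \<in> {0..<5}"
    and better: "cycle_payoff p q < cycle_payoff r q \<or> cycle_payoff q p < cycle_payoff r p"
    using cycle_payoff_deviation by blast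
  have "cycle_payoff r q \<le> cycle_payoff p q" "cycle_payoff r p \<le> cycle_payoff q p"
    using nash r pq
    by (auto simp: rvor_nash_def rvor_payoff1_def rvor_payoff2_def card_rvor_set_cycle_clique)
  with better show False by simp
qed

theorem corollary3:
  shows "\<exists>Q :: nat tgraph. temporal_clique Q \<and> monotonically_growing Q \<and>
           \<not> (\<exists>p1 p2. rvor_nash Q p1 p2)"
proof -
  have "temporal_clique cycle_clique"
    unfolding cycle_clique_def using cycle_label_bound
    by (intro temporal_clique_appearance_graph[where T = 4]) auto
  moreover have "monotonically_growing cycle_clique"
    unfolding cycle_clique_def by (rule monotonically_growing_appearance_graph)
  ultimately show ?thesis using not_rvor_nash_cycle_clique by blast
qed

end
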